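(* Let $G=(V,q)$ be a finite graph satisfying $CD(0,n)$ for some $n<\infty$. Let $u_0\in C(V)$ satisfy $\|\Gamma u_0\|_\infty\le q_{\min}/2$, and let $(u_t)_{t\ge 0}$ be the solution of $\partial_t u_t=\Delta u_t+\Gamma u_t$ with initial value $u_0$. Then for all $x,y\in V$ and all $T_2>T_1>0$, $$u_{T_1}(x)-u_{T_2}(y)\le\frac n2\log\left(\frac{T_2}{T_1}\right)+\frac{2\,d(x,y)^2}{q_{\min}(T_2-T_1)} .$$
   Context: A finite graph $G=(V,q)$ consists of a finite set $V$ and a function $q:V^2\to[0,\infty)$ with $q(x,x)=0$ for all $x\in V$ ($q$ need not be symmetric). Write $x\sim y$ if $q(x,y)>0$ or $q(y,x)>0$. The combinatorial distance is $d(x,y)=\inf\{k: x=x_0\sim\cdots\sim x_k=y\}$ (equal to $\infty$ if there is no such path, in which case the right-hand side of the claim is $+\infty$). Put $q_{\min}:=\min\{q(x,y):x,y\in V,\ q(x,y)>0\}$ (this presupposes that $q$ is not identically zero). $C(V)=\mathbb{R}^V$, and $\|f\|_\infty=\sup_{x\in V}|f(x)|$. The Laplacian is $\Delta f(x)=\sum_{y}q(x,y)(f(y)-f(x))$. The operators $\Gamma_k:C(V)\times C(V)\to C(V)$ are defined by $\Gamma_0(f,g)=fg$ and $2\Gamma_{k+1}(f,g)=\Delta\Gamma_k(f,g)-\Gamma_k(f,\Delta g)-\Gamma_k(\Delta f,g)$; write $\Gamma_k f=\Gamma_k(f,f)$ and $\Gamma=\Gamma_1$, so $\Gamma f(x)=\frac12\sum_y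 q(x,y)(f(y)-f(x))^2$. $G$ satisfies $CD(K,n)$ (with $K\in\mathbb{R}$, $n\in(0,\infty]$, $1/\infty=0$) if $\Gamma_2 f\ge\frac1n(\Delta f)^2+K\,\Gamma f$ pointwise on $V$ for all $f\in C(V)$. The ODE system $\partial_t u_t=\Delta u_t+\Gamma u_t$ has a unique maximal solution for each initial value $u_0$; if $G$ satisfies $CD(0,\infty)$ (in particular under $CD(0,n)$) and $\|\Gamma u_0\|_\infty\le q_{\min}/2$, it exists for all $t\ge 0$. *)

theory Defs
  imports "HOL-Analysis.Analysis"
begin

text \<open>
  The vertex set is the universe of a finite type \<open>'v\<close>, so that \<open>C(V)\<close> is the full function type
  \<open>'v \<Rightarrow> real\<close>.
\<close>

definition finite_graph :: "('v::finite \<Rightarrow> 'v \<Rightarrow> real) \<Rightarrow> bool" where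
  "finite_graph q \<longleftrightarrow> (\<forall>x y. 0 \<le> q x y) \<and> (\<forall>x. q x x = 0)"

definition adjacent :: "('v::finite \<Rightarrow> 'v \<Rightarrow> real) \<Rightarrow> 'v \<Rightarrow> 'v \<Rightarrow> bool" where
  "adjacent q x y \<longleftrightarrow> q x y > 0 \<or> q y x > 0"

text \<open>In \<^typ>\<open>enat\<close> the infimum of the empty set is \<open>\<infinity>\<close>.\<close>

definition graph_dist :: "('v::finite \<Rightarrow> 'v \<Rightarrow> real) \<Rightarrow> 'v \<Rightarrow> 'v \<Rightarrow> enat" where
  "graph_dist q x y =
     Inf {enat k | k. \<exists>p :: nat \<Rightarrow> 'v. p 0 = x \<and> p k = y \<and> (\<forall>i<k. adjacent q (p i) (p (Suc i)))}"

text \<open>Meaningful only if \<open>q\<close> is not identically zero.\<close>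

definition q_min :: "('v::finite \<Rightarrow> 'v \<Rightarrow> real) \<Rightarrow> real" where
  "q_min q = Min {q x y | x y. q x y > 0}"

definition sup_norm :: "('v::finite \<Rightarrow> real) \<Rightarrow> real" where
  "sup_norm f = (SUP x. \<bar>f x\<bar>)"

definition laplacian :: "('v::finite \<Rightarrow> 'v \<Rightarrow> real) \<Rightarrow> ('v \<Rightarrow> real) \<Rightarrow> 'v \<Rightarrow> real" where
  "laplacian q f x = (\<Sum>y\<in>UNIV. q x y * (f y - f x))"

primrec Gamma_bilin ::
  "('v::finite \<Rightarrow> 'v \<Rightarrow> real) \<Rightarrow> nat \<Rightarrow> ('v \<Rightarrow> real) \<Rightarrow> ('v \<Rightarrow> real) \<Rightarrow> 'v \<Rightarrow> real" where
  "Gamma_bilin q 0 f g = (\<lambda>x. f x * g x)"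
| "Gamma_bilin q (Suc k) f g = (\<lambda>x.
     (laplacian q (Gamma_bilin q k f g) x
      - Gamma_bilin q k f (laplacian q g) x
      - Gamma_bilin q k (laplacian q f) g x) / 2)"

definition Gamma_quad ::
  "('v::finite \<Rightarrow> 'v \<Rightarrow> real) \<Rightarrow> nat \<Rightarrow> ('v \<Rightarrow> real) \<Rightarrow> 'v \<Rightarrow> real" where
  "Gamma_quad q k f = Gamma_bilin q k f f"

text \<open>
  The dimension \<open>n\<close> ranges over \<open>(0, \<infinity>]\<close>; in \<^typ>\<open>ereal\<close> we have \<open>1 / \<infinity> = 0\<close>.
\<close>

definition CD :: "('v::finite \<Rightarrow> 'v \<Rightarrow> real) \<Rightarrow> real \<Rightarrow> ereal \<Rightarrow> bool" where
  "CD q K n \<longleftrightarrow> (\<forall>f x.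
     Gamma_quad q 2 f x \<ge> real_of_ereal (1 / n) * (laplacian q f x)\<^sup>2 + K * Gamma_quad q 1 f x)"

text \<open>
  A global solution on \<open>[0, \<infinity>)\<close>; at \<open>t = 0\<close> the derivative is one-sided.
\<close>

definition solves_gamma_flow ::
  "('v::finite \<Rightarrow> 'v \<Rightarrow> real) \<Rightarrow> ('v \<Rightarrow> real) \<Rightarrow> (real \<Rightarrow> 'v \<Rightarrow> real) \<Rightarrow> bool" where
  "solves_gamma_flow q u0 u \<longleftrightarrow> u 0 = u0 \<and>
     (\<forall>t\<ge>0. \<forall>x. ((\<lambda>s. u s x) has_real_derivative
        laplacian q (u t) x + Gamma_quad q 1 (u t) x) (at t within {0..}))"

end

theory Submission
  imports Defs
begin

text \<open>
  Write \<open>\<Delta>\<^sub>u g = \<Delta> g + 2 \<Gamma>(u, g)\<close>, that is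
  \<open>\<Delta>\<^sub>u g x = \<Sum>y. q x y (1 + u y - u x) (g y - g x)\<close>. Along the flow,
  \<open>\<partial>\<^sub>t \<Gamma> u = \<Delta>\<^sub>u \<Gamma> u - 2 \<Gamma>\<^sub>2 u\<close> and \<open>\<partial>\<^sub>t \<Delta> u = \<Delta>\<^sub>u \<Delta> u + 2 \<Gamma>\<^sub>2 u\<close>. As long as
  \<open>\<Gamma> u \<le> q\<^sub>m\<^sub>i\<^sub>n / 2\<close> the weights of \<open>\<Delta>\<^sub>u\<close> are nonnegative, so \<open>\<Delta>\<^sub>u\<close> obeys a maximum principle.
  The first equation then shows that the gradient bound persists, and the second one that
  \<open>t \<Delta> u \<ge> - n / 2\<close> (Li--Yau). Hence \<open>\<phi> = u + (n / 2) ln t\<close> satisfies \<open>\<partial>\<^sub>t \<phi> \<ge> \<Gamma> u\<close>, and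
  across an edge \<open>\<Gamma> u\<close> controls the squared difference of \<open>\<phi>\<close>, which gives a Riccati inequality.
  The Harnack inequality follows by traversing a shortest path at constant speed.
\<close>

section \<open>Maximum principle for functions on a finite vertex set\<close>

text \<open>At the first touching time \<open>f\<close> has come up to \<open>b\<close> from
  strictly below at some vertex, which is incompatible with the strict derivative inequality
  \<open>touch\<close>.\<close>

lemma barrier_principle:
  fixes f f' :: "real \<Rightarrow> 'v::finite \<Rightarrow> real" and b b' :: "real \<Rightarrow> real"
  assumes f: "\<And>t x. 0 \<le> t \<Longrightarrow> t \<le> T \<Longrightarrow> ((\<lambda>s. f s x) has_real_derivative f' t x) (at t within {0..})"
    and b: "\<And>t. 0 \<le> t \<Longrightarrow> t \<le> T \<Longrightarrow> (b has_real_derivative b' t) (at t within {0..})"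
    and init: "\<And>x. f 0 x < b 0"
    and touch: "\<And>t x. 0 < t \<Longrightarrow> t \<le> T \<Longrightarrow> f t x = b t \<Longrightarrow> (\<And>y. f t y \<le> b t) \<Longrightarrow> f' t x < b' t"
    and t: "0 \<le> t" "t \<le> T"
  shows "f t x < b t"
proof (rule ccontr)
  assume neg: "\<not> f t x < b t"
  define g where "g = (\<lambda>s x. f s x - b s)"
  have dg: "((\<lambda>s. g s x) has_real_derivative f' t x - b' t) (at t within {0..})"
    if "0 \<le> t" "t \<le> T" for t x
    unfolding g_def by (intro DERIV_diff f b that)
  have cont: "continuous_on {0..T} (\<lambda>s. g s x)" for x
    by (rule DERIV_continuous_on, rule DERIV_subset[OF dg]) auto
  \<comment> \<open>A finite union of closed sets is closed, so the first touching time
    \<open>Inf S\<close> is attained.\<close>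
  define S where "S = (\<Union>x. {s \<in> {0..T}. 0 \<le> g s x})"
  have "closed {s \<in> {0..T}. 0 \<le> g s x}" for x
  proof -
    have "{s \<in> {0..T}. 0 \<le> g s x} = {0..T} \<inter> (\<lambda>s. g s x) -` {0..}" by auto
    then show ?thesis using continuous_closed_preimage[OF cont] by simp
  qed
  then have "closed S" unfolding S_def by (intro closed_UN) auto
  moreover have "t \<in> S" using neg t by (auto simp: S_def g_def not_less)
  moreover have bdd: "bdd_below S" by (rule bdd_belowI[of _ 0]) (auto simp: S_def)
  ultimately have inS: "Inf S \<in> S" by (intro closed_contains_Inf) auto
  define r where "r = Inf S"
  obtain z where z: "0 \<le> r" "r \<le> T" "0 \<le> g r z" using inS by (auto simp: S_def r_def)
  have r0: "0 < r" using z init[of z] by (cases "r = 0") (auto simp: g_def)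
  have before: "g s y < 0" if "0 \<le> s" "s < r" for s y
  proof (rule ccontr)
    assume "\<not> g s y < 0"
    then have "s \<in> S" using that z by (auto simp: S_def not_less)
    then have "r \<le> s" unfolding r_def using bdd by (rule cInf_lower)
    then show False using that by simp
  qed
  have lim: "((\<lambda>s. g s y) \<longlongrightarrow> g r y) (at_left r)" for y
  proof -
    have "((\<lambda>s. g s y) \<longlongrightarrow> g r y) (at r within {0..T})"
      using cont z by (auto simp: continuous_on_def)
    then have "((\<lambda>s. g s y) \<longlongrightarrow> g r y) (at r within {0..r})"
      by (rule tendsto_within_subset) (use z in auto)
    then show ?thesis using r0 by (simp add: at_within_Icc_at_left)
  qed
  have le: "g r y \<le> 0" for y
  proof (rule tendsto_upperbound[OF lim])
    have "\<forall>s>0. s < r \<longrightarrow> g s y \<le> 0" using before[of _ y] by (auto intro: less_imp_le)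
    then show "\<forall>\<^sub>F s in at_left r. g s y \<le> 0" using eventually_at_left[OF r0] r0 by blast
  qed simp
  have "f' r z - b' r < 0"
    using touch[OF r0 z(2), of z] le z(3) by (force simp: g_def intro: antisym)
  from has_real_derivative_neg_dec_left[OF dg[OF z(1,2)] this]
  obtain d where d: "d > 0" "\<And>h. h > 0 \<Longrightarrow> r - h \<in> {0..} \<Longrightarrow> h < d \<Longrightarrow> g r z < g (r - h) z"
    by blast
  \<comment> \<open>The cap by \<open>r\<close> keeps \<open>r - h\<close> in \<open>{0..}\<close>,
    where the derivative is taken.\<close>
  define h where "h = min (d/2) r"
  have "h > 0" "h < d" "h \<le> r" using d(1) r0 by (auto simp: h_def min_def)
  then show False using d(2)[of h] before[of "r - h" z] z(3) by simp
qed

section \<open>Riccati inequalities in one variable\<close>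

text \<open>Dividing by the square of \<open>J\<close> shows that
  \<open>- inverse (J t) - c * t\<close> is nondecreasing; dropping the positive term
  \<open>inverse (J b)\<close> makes the bound strict.\<close>

lemma riccati_bound:
  fixes J J' :: "real \<Rightarrow> real"
  assumes "a < b" "0 < c"
    and d: "\<And>t. a \<le> t \<Longrightarrow> t \<le> b \<Longrightarrow> (J has_real_derivative J' t) (at t)"
    and pos: "\<And>t. a \<le> t \<Longrightarrow> t \<le> b \<Longrightarrow> 0 < J t"
    and ric: "\<And>t. a \<le> t \<Longrightarrow> t \<le> b \<Longrightarrow> c * (J t)\<^sup>2 \<le> J' t"
  shows "J a < 1 / (c * (b - a))"
proof -
  define F where "F = (\<lambda>t. - inverse (J t) - c * t)"
  have "F a \<le> F b"
  proof (rule DERIV_nonneg_imp_nondecreasing[of a b F])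
    fix t assume t: "a \<le> t" "t \<le> b"
    have "(F has_real_derivative J' t / (J t)\<^sup>2 - c) (at t)"
      unfolding F_def using pos[OF t]
      by (auto intro!: derivative_eq_intros d[OF t] simp: power2_eq_square field_simps)
    moreover have "0 \<le> J' t / (J t)\<^sup>2 - c" using ric[OF t] pos[OF t] by (simp add: field_simps)
    ultimately show "\<exists>y. (F has_real_derivative y) (at t) \<and> 0 \<le> y" by blast
  qed (use assms in simp)
  then have "c * (b - a) \<le> inverse (J a) - inverse (J b)" by (simp add: F_def algebra_simps)
  also have "\<dots> < inverse (J a)" using pos[of b] assms(1) by simp
  finally have "c * (b - a) < inverse (J a)" .
  moreover have "0 < J a" "0 < c * (b - a)" using pos[of a] assms by auto
  ultimately show ?thesis by (simp add: field_simps)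
qed

text \<open>Both functions are nondecreasing, so if \<phi> starts above \<open>\<psi> b\<close> it
  stays above. Freezing \<psi> at its final value then only shrinks the gap, and
  \<open>\<phi> t - \<psi> b\<close> satisfies the hypotheses of
  \<open>riccati_bound\<close>.\<close>

lemma riccati_jump:
  fixes \<phi> \<psi> \<phi>' \<psi>' :: "real \<Rightarrow> real"
  assumes ab: "a < b" "0 < c"
    and \<phi>: "\<And>t. a \<le> t \<Longrightarrow> t \<le> b \<Longrightarrow> (\<phi> has_real_derivative \<phi>' t) (at t)"
    and \<psi>: "\<And>t. a \<le> t \<Longrightarrow> t \<le> b \<Longrightarrow> (\<psi> has_real_derivative \<psi>' t) (at t)"
    and ric: "\<And>t. a \<le> t \<Longrightarrow> t \<le> b \<Longrightarrow> c * (\<phi> t - \<psi> t)\<^sup>2 \<le> \<phi>' t"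
    and mono: "\<And>t. a \<le> t \<Longrightarrow> t \<le> b \<Longrightarrow> 0 \<le> \<psi>' t"
  shows "\<phi> a - \<psi> b \<le> 1 / (c * (b - a))"
proof (cases "\<phi> a \<le> \<psi> b")
  case True
  have "0 < 1 / (c * (b - a))" using ab by simp
  then show ?thesis using True by linarith
next
  case False
  have \<phi>_ge: "\<phi> a \<le> \<phi> t" if t: "a \<le> t" "t \<le> b" for t
  proof (rule DERIV_nonneg_imp_nondecreasing[OF t(1)])
    fix s assume s: "a \<le> s" "s \<le> t"
    have "0 \<le> c * (\<phi> s - \<psi> s)\<^sup>2" using ab by simp
    then show "\<exists>y. (\<phi> has_real_derivative y) (at s) \<and> 0 \<le> y"
      using \<phi>[of s] ric[of s] s t by force
  qed
  have \<psi>_le: "\<psi> t \<le> \<psi> b" if t: "a \<le> t" "t \<le> b" for t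
  proof (rule DERIV_nonneg_imp_nondecreasing[OF t(2)])
    fix s assume "t \<le> s" "s \<le> b"
    then show "\<exists>y. (\<psi> has_real_derivative y) (at s) \<and> 0 \<le> y"
      using \<psi>[of s] mono[of s] t by auto
  qed
  have "\<phi> a - \<psi> b < 1 / (c * (b - a))"
  proof (rule riccati_bound[of a b c "\<lambda>t. \<phi> t - \<psi> b" \<phi>'])
    fix t assume t: "a \<le> t" "t \<le> b"
    show "((\<lambda>t. \<phi> t - \<psi> b) has_real_derivative \<phi>' t) (at t)"
      using \<phi>[OF t] by (auto intro!: derivative_eq_intros)
    show pos: "0 < \<phi> t - \<psi> b" using False \<phi>_ge[OF t] by simp
    have "(\<phi> t - \<psi> b)\<^sup>2 \<le> (\<phi> t - \<psi> t)\<^sup>2" using pos \<psi>_le[OF t] by (intro power_mono) auto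
    then show "c * (\<phi> t - \<psi> b)\<^sup>2 \<le> \<phi>' t" using ric[OF t] ab(2)
      by (meson mult_le_cancel_left_pos order_trans)
  qed (use ab in auto)
  then show ?thesis by simp
qed

section \<open>Calculus of the \<Gamma> operators\<close>

lemma Gamma_bilin_1:
  "Gamma_bilin q 1 f g x = (\<Sum>y\<in>UNIV. q x y * (f y - f x) * (g y - g x)) / 2"
  by (simp add: laplacian_def sum_subtractf[symmetric] sum_distrib_left sum_distrib_right algebra_simps)

lemma Gamma_quad_1: "Gamma_quad q 1 f x = (\<Sum>y\<in>UNIV. q x y * (f y - f x)\<^sup>2) / 2"
  by (simp only: Gamma_quad_def Gamma_bilin_1 power2_eq_square mult.assoc)

lemma Gamma_bilin_1_sym: "Gamma_bilin q 1 f g = Gamma_bilin q 1 g f"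
  by (rule ext) (simp only: Gamma_bilin_1 mult.commute mult.left_commute)

text \<open>Symmetry of \<Gamma> merges the two cross terms of the recursion.\<close>

lemma Gamma_quad_2:
  "2 * Gamma_quad q 2 f x
    = laplacian q (Gamma_quad q 1 f) x - 2 * Gamma_bilin q 1 f (laplacian q f) x"
proof -
  have "Gamma_quad q 2 f x = (laplacian q (Gamma_bilin q 1 f f) x
      - Gamma_bilin q 1 f (laplacian q f) x - Gamma_bilin q 1 (laplacian q f) f x) / 2"
    by (simp add: Gamma_quad_def numeral_2_eq_2)
  then show ?thesis
    using fun_cong[OF Gamma_bilin_1_sym[of q "laplacian q f" f], of x]
    by (simp add: Gamma_quad_def[abs_def] del: Gamma_bilin.simps One_nat_def)
qed

text \<open>As a single sum, the drift operator shows the weights whose signs decide whether a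
  maximum principle holds.\<close>

lemma drift_laplacian:
  "laplacian q g x + 2 * Gamma_bilin q 1 u g x
    = (\<Sum>y\<in>UNIV. q x y * (1 + u y - u x) * (g y - g x))"
  unfolding Gamma_bilin_1 laplacian_def
  by (simp add: sum.distrib[symmetric] algebra_simps)

lemma CD_ereal:
  assumes "CD q K (ereal n)" "0 < n"
  shows "(laplacian q f x)\<^sup>2 / n + K * Gamma_quad q 1 f x \<le> Gamma_quad q 2 f x"
  using assms by (simp add: CD_def one_ereal_def del: One_nat_def)

section \<open>Edge estimates and the sign of the drift weights\<close>

context
  fixes q :: "'v::finite \<Rightarrow> 'v \<Rightarrow> real"
  assumes graph: "finite_graph q" and nonzero: "\<exists>a b. q a b > 0"
begin

lemma q_nonneg: "0 \<le> q x y"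
  using graph by (simp add: finite_graph_def)

lemma finite_edge_weights: "finite {q x y | x y. q x y > 0}"
  by (rule finite_subset[of _ "range (\<lambda>(x, y). q x y)"]) auto

lemma q_min_le: "0 < q x y \<Longrightarrow> q_min q \<le> q x y"
  unfolding q_min_def by (rule Min_le[OF finite_edge_weights]) blast

lemma q_min_pos: "0 < q_min q"
  unfolding q_min_def using nonzero by (subst Min_gr_iff[OF finite_edge_weights]) auto

text \<open>One summand of \<Gamma> is kept. Since \<Gamma> at \<open>x\<close> sees only the
  outgoing weights \<open>q x y\<close>, the orientation of the edge matters.\<close>

lemma edge_le_Gamma:
  assumes "0 < q x y"
  shows "q_min q / 2 * (f y - f x)\<^sup>2 \<le> Gamma_quad q 1 f x"
proof -
  have "q_min q * (f y - f x)\<^sup>2 \<le> q x y * (f y - f x)\<^sup>2"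
    using q_min_le[OF assms] by (intro mult_right_mono) auto
  also have "\<dots> \<le> (\<Sum>y\<in>UNIV. q x y * (f y - f x)\<^sup>2)"
    by (rule member_le_sum) (auto simp: q_nonneg)
  finally show ?thesis unfolding Gamma_quad_1 by simp
qed

lemma Gamma_quad_nonneg: "0 \<le> Gamma_quad q 1 f x"
  unfolding Gamma_quad_1 by (simp add: sum_nonneg q_nonneg)

text \<open>The threshold \<open>q_min q / 2\<close> is what forces \<bar>f y - f x\<bar> \<le> 1
  whenever \<open>0 < q x y\<close>.\<close>

lemma drift_weight_nonneg:
  assumes "Gamma_quad q 1 f x \<le> q_min q / 2"
  shows "0 \<le> q x y * (1 + f y - f x)"
proof (cases "0 < q x y")
  case True
  then have "q_min q / 2 * (f y - f x)\<^sup>2 \<le> q_min q / 2 * 1"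
    using edge_le_Gamma[of x y f] assms by simp
  then have "(f y - f x)\<^sup>2 \<le> 1" using q_min_pos by (subst (asm) mult_le_cancel_left_pos) auto
  then have "\<bar>f y - f x\<bar> \<le> 1" by (simp add: abs_square_le_1)
  then show ?thesis using True by simp
next
  case False
  then show ?thesis using q_nonneg[of x y] by simp
qed

text \<open>
  The weights of the drift operator may become negative, but only by an amount proportional to the
  violation \<open>e\<close> of the gradient bound.
\<close>

lemma drift_at_Gamma_maximum:
  assumes "Gamma_quad q 1 f x = q_min q / 2 + e" "0 \<le> e" "e \<le> 1"
    and max: "\<And>y. Gamma_quad q 1 f y \<le> Gamma_quad q 1 f x"
  shows "(\<Sum>y\<in>UNIV. q x y * (1 + f y - f x) * (Gamma_quad q 1 f y - Gamma_quad q 1 f x))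
    \<le> (\<Sum>a\<in>UNIV. \<Sum>b\<in>UNIV. q a b) / q_min q * (q_min q / 2 + 1) * e" (is "?L \<le> _")
proof -
  \<comment> \<open>The factor \<open>e / q_min q\<close> bounds the excess of
    \<open>f x - f y\<close> over 1, and \<open>q_min q / 2 + 1\<close> bounds the drop of \<Gamma>
    from \<open>x\<close> to \<open>y\<close>.\<close>
  let ?C = "e / q_min q * (q_min q / 2 + 1)"
  have C: "0 \<le> ?C" using assms q_min_pos by simp
  have "?L \<le> (\<Sum>y\<in>UNIV. q x y * ?C)"
  proof (rule sum_mono)
    fix y
    define \<delta> where "\<delta> = f x - f y"
    define G where "G = Gamma_quad q 1 f x - Gamma_quad q 1 f y"
    have G: "0 \<le> G" "G \<le> q_min q / 2 + 1"
      using max[of y] Gamma_quad_nonneg[of f y] assms by (auto simp: G_def)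
    have "q x y * ((\<delta> - 1) * G) \<le> q x y * ?C"
    proof (cases "0 < q x y \<and> 1 < \<delta>")
      case True
      have "q_min q / 2 * \<delta>\<^sup>2 \<le> q_min q / 2 + e"
        using edge_le_Gamma[of x y f] True assms(1) by (simp add: \<delta>_def power2_commute)
      \<comment> \<open>The square lies above its tangent line at 1, so the excess \<delta> - 1 is
        linear in \<open>e\<close>.\<close>
      moreover have "q_min q / 2 * (1 + 2 * (\<delta> - 1)) \<le> q_min q / 2 * \<delta>\<^sup>2"
        using q_min_pos zero_le_power2[of "\<delta> - 1"]
        by (intro mult_left_mono) (auto simp: power2_eq_square algebra_simps)
      ultimately have "(\<delta> - 1) * q_min q \<le> e" by (simp add: algebra_simps)
      then have "\<delta> - 1 \<le> e / q_min q" using q_min_pos by (simp add: field_simps)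
      then have "(\<delta> - 1) * G \<le> ?C" using G assms q_min_pos by (intro mult_mono) auto
      then show ?thesis using True by (intro mult_left_mono) auto
    next
      case False
      show ?thesis
      proof (cases "q x y = 0")
        case False
        with \<open>\<not> (0 < q x y \<and> 1 < \<delta>)\<close> have "(\<delta> - 1) * G \<le> 0"
          using q_nonneg[of x y] G(1) by (intro mult_nonpos_nonneg) auto
        then show ?thesis using C q_nonneg[of x y] by (intro mult_left_mono) auto
      qed simp
    qed
    moreover have "q x y * (1 + f y - f x) * (Gamma_quad q 1 f y - Gamma_quad q 1 f x)
        = q x y * ((\<delta> - 1) * G)" by (simp add: \<delta>_def G_def algebra_simps)
    ultimately show "q x y * (1 + f y - f x) * (Gamma_quad q 1 f y - Gamma_quad q 1 f x)
        \<le> q x y * ?C" by (simp only:)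
  qed
  also have "\<dots> = (\<Sum>y\<in>UNIV. q x y) * ?C" by (simp only: sum_distrib_right)
  \<comment> \<open>Passing from one row to all weights makes the constant independent of the
    vertex.\<close>
  also have "\<dots> \<le> (\<Sum>a\<in>UNIV. \<Sum>b\<in>UNIV. q a b) * ?C"
    by (intro mult_right_mono[OF _ C] member_le_sum[of x UNIV "\<lambda>a. \<Sum>b\<in>UNIV. q a b"])
      (auto simp: sum_nonneg q_nonneg)
  finally show ?thesis by (simp add: mult_ac)
qed

section \<open>Evolution equations along the flow\<close>

context
  fixes u0 :: "'v \<Rightarrow> real" and u :: "real \<Rightarrow> 'v \<Rightarrow> real"
  assumes sol: "solves_gamma_flow q u0 u"
begin

lemma flow_deriv:
  "0 \<le> t \<Longrightarrow> ((\<lambda>s. u s x) has_real_derivative laplacian q (u t) x + Gamma_quad q 1 (u t) x)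
    (at t within {0..})"
  using sol by (simp add: solves_gamma_flow_def)

text \<open>Since \<Gamma> is quadratic, its time derivative is twice \<Gamma>(u, \<Delta>u +
  \<Gamma>u). \<open>Gamma_quad_2\<close> rewrites the part with \<Delta>u, and the part with
  \<Gamma>u is the drift term.\<close>

lemma flow_Gamma_deriv:
  assumes "0 \<le> t"
  shows "((\<lambda>s. Gamma_quad q 1 (u s) x) has_real_derivative
     (\<Sum>y\<in>UNIV. q x y * (1 + u t y - u t x) * (Gamma_quad q 1 (u t) y - Gamma_quad q 1 (u t) x))
     - 2 * Gamma_quad q 2 (u t) x) (at t within {0..})"
proof -
  define v where "v = (\<lambda>x. laplacian q (u t) x + Gamma_quad q 1 (u t) x)"
  have dv: "((\<lambda>s. u s x) has_real_derivative v x) (at t within {0..})" for x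
    using flow_deriv[OF assms] by (simp add: v_def)
  have "((\<lambda>s. Gamma_quad q 1 (u s) x) has_real_derivative 2 * Gamma_bilin q 1 (u t) v x)
     (at t within {0..})"
    unfolding Gamma_quad_1[of q "u s" for s] Gamma_bilin_1
    by (auto intro!: derivative_eq_intros dv sum.cong
        simp: sum_distrib_left mult_ac simp del: One_nat_def)
  moreover have "2 * Gamma_bilin q 1 (u t) v x = 2 * Gamma_bilin q 1 (u t) (laplacian q (u t)) x
      + 2 * Gamma_bilin q 1 (u t) (Gamma_quad q 1 (u t)) x"
    unfolding Gamma_bilin_1 v_def by (simp add: sum.distrib[symmetric] algebra_simps del: One_nat_def)
  ultimately show ?thesis
    unfolding drift_laplacian[symmetric] using Gamma_quad_2[of q "u t" x]
    by (simp add: add.commute del: Gamma_bilin.simps One_nat_def)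
qed

text \<open>By linearity the derivative is \<Delta>\<Delta>u + \<Delta>\<Gamma>u;
  \<open>Gamma_quad_2\<close> turns \<Delta>\<Gamma>u into the drift term plus twice the iterated
  operator.\<close>

lemma flow_laplacian_deriv:
  assumes "0 \<le> t"
  shows "((\<lambda>s. laplacian q (u s) x) has_real_derivative
     (\<Sum>y\<in>UNIV. q x y * (1 + u t y - u t x) * (laplacian q (u t) y - laplacian q (u t) x))
     + 2 * Gamma_quad q 2 (u t) x) (at t within {0..})"
proof -
  define v where "v = (\<lambda>x. laplacian q (u t) x + Gamma_quad q 1 (u t) x)"
  have dv: "((\<lambda>s. u s x) has_real_derivative v x) (at t within {0..})" for x
    using flow_deriv[OF assms] by (simp add: v_def)
  have "((\<lambda>s. laplacian q (u s) x) has_real_derivative laplacian q v x) (at t within {0..})"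
    unfolding laplacian_def[of q "u s" for s] laplacian_def[of q v]
    by (auto intro!: derivative_eq_intros dv sum.cong
        simp del: One_nat_def)
  moreover have "laplacian q v x
      = laplacian q (laplacian q (u t)) x + laplacian q (Gamma_quad q 1 (u t)) x"
    unfolding laplacian_def[of q v] laplacian_def[of q "laplacian q (u t)"]
      laplacian_def[of q "Gamma_quad q 1 (u t)"]
    by (simp add: v_def sum.distrib[symmetric] algebra_simps del: One_nat_def)
  ultimately show ?thesis
    unfolding drift_laplacian[symmetric] using Gamma_quad_2[of q "u t" x]
    by (simp add: add.commute del: Gamma_bilin.simps One_nat_def)
qed

section \<open>Gradient bound and Li--Yau estimate\<close>

context
  fixes n :: real
  assumes n: "0 < n" and curv: "CD q 0 (ereal n)"
    and small: "sup_norm (Gamma_quad q 1 u0) \<le> q_min q / 2"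
begin

text \<open>Nonnegative drift weights presuppose this very bound, so a direct maximum principle
  would be circular. An exponential barrier of rate \<open>C + 1\<close> outgrows the drift, which
  is at most \<open>C * b s\<close> at a touching point; the curvature term has the right
  sign.\<close>

lemma flow_Gamma_le:
  assumes t: "0 \<le> t"
  shows "Gamma_quad q 1 (u t) x \<le> q_min q / 2"
proof (rule field_le_epsilon)
  fix e :: real assume e: "0 < e"
  define C where "C = (\<Sum>a\<in>UNIV. \<Sum>b\<in>UNIV. q a b) / q_min q * (q_min q / 2 + 1)"
  define \<eta> where "\<eta> = min 1 e"
  \<comment> \<open>Normalised to end at \<eta> \<le> e, and at most 1 up to time \<open>t\<close>,
    as \<open>drift_at_Gamma_maximum\<close> requires.\<close>
  define b where "b = (\<lambda>s. \<eta> * exp ((C + 1) * (s - t)))"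
  have \<eta>: "0 < \<eta>" "\<eta> \<le> 1" "\<eta> \<le> e" using e by (auto simp: \<eta>_def)
  have C: "0 \<le> C" unfolding C_def using q_min_pos
    by (intro mult_nonneg_nonneg divide_nonneg_nonneg sum_nonneg q_nonneg) auto
  have bpos: "0 < b s" for s using \<eta> by (simp add: b_def)
  have b1: "b s \<le> 1" if "s \<le> t" for s
  proof -
    have "(C + 1) * (s - t) \<le> 0" using C that by (intro mult_nonneg_nonpos) auto
    then have "\<eta> * exp ((C + 1) * (s - t)) \<le> 1 * 1" using \<eta> by (intro mult_mono) auto
    then show ?thesis by (simp add: b_def)
  qed
  have "Gamma_quad q 1 (u t) x - q_min q / 2 < b t"
  proof (rule barrier_principle[where f = "\<lambda>s x. Gamma_quad q 1 (u s) x - q_min q / 2" and b = b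
        and T = t and b' = "\<lambda>s. (C + 1) * b s"])
    fix s x assume s: "0 \<le> s" "s \<le> t"
    show "((\<lambda>s. Gamma_quad q 1 (u s) x - q_min q / 2) has_real_derivative
       (\<Sum>y\<in>UNIV. q x y * (1 + u s y - u s x) * (Gamma_quad q 1 (u s) y - Gamma_quad q 1 (u s) x))
       - 2 * Gamma_quad q 2 (u s) x) (at s within {0..})"
      using DERIV_diff[OF flow_Gamma_deriv[OF s(1)] DERIV_const] by simp
  next
    fix s
    show "(b has_real_derivative (C + 1) * b s) (at s within {0..})"
      unfolding b_def by (auto intro!: derivative_eq_intros)
  next
    fix x
    have "\<bar>Gamma_quad q 1 u0 x\<bar> \<le> sup_norm (Gamma_quad q 1 u0)"
      unfolding sup_norm_def by (rule cSUP_upper) auto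
    then have "Gamma_quad q 1 (u 0) x \<le> q_min q / 2"
      using small sol by (simp add: solves_gamma_flow_def)
    then show "Gamma_quad q 1 (u 0) x - q_min q / 2 < b 0" using bpos[of 0] by simp
  next
    fix s x
    assume s: "0 < s" "s \<le> t" and eq: "Gamma_quad q 1 (u s) x - q_min q / 2 = b s"
      and le: "\<And>y. Gamma_quad q 1 (u s) y - q_min q / 2 \<le> b s"
    have "(\<Sum>y\<in>UNIV. q x y * (1 + u s y - u s x)
        * (Gamma_quad q 1 (u s) y - Gamma_quad q 1 (u s) x)) \<le> C * b s"
      unfolding C_def
    proof (rule drift_at_Gamma_maximum)
      show "Gamma_quad q 1 (u s) x = q_min q / 2 + b s" using eq by simp
      show "Gamma_quad q 1 (u s) y \<le> Gamma_quad q 1 (u s) x" for y using eq le[of y] by simp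
    qed (use bpos[of s] b1[OF s(2)] in auto)
    moreover have "0 \<le> Gamma_quad q 2 (u s) x"
      using CD_ereal[OF curv n, of "u s" x] n
      by (smt (verit) divide_nonneg_pos zero_le_power2 mult_zero_left)
    ultimately show "(\<Sum>y\<in>UNIV. q x y * (1 + u s y - u s x)
        * (Gamma_quad q 1 (u s) y - Gamma_quad q 1 (u s) x)) - 2 * Gamma_quad q 2 (u s) x
        < (C + 1) * b s"
      using bpos[of s] by (simp add: algebra_simps)
  qed (use t in auto)
  then show "Gamma_quad q 1 (u t) x \<le> q_min q / 2 + e" using \<eta> by (simp add: b_def)
qed

text \<open>The factor \<open>t\<close> makes the initial condition trivial. At a touching point
  \<open>x\<close> minimises \<Delta>u, so the drift is nonnegative, and the curvature condition
  supplies a quadratic term that beats \<Delta>u.\<close>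

lemma li_yau:
  assumes t: "0 \<le> t"
  shows "- (n / 2) \<le> t * laplacian q (u t) x"
proof -
  have "- (t * laplacian q (u t) x) \<le> n / 2"
  proof (rule field_le_epsilon)
    fix e :: real assume e: "0 < e"
    let ?L = "\<lambda>s. laplacian q (u s)"
    let ?S = "\<lambda>s x. \<Sum>y\<in>UNIV. q x y * (1 + u s y - u s x) * (?L s y - ?L s x)"
    have "- (t * ?L t x) < n / 2 + e"
    proof (rule barrier_principle[where f = "\<lambda>s x. - (s * ?L s x)" and b = "\<lambda>_. n / 2 + e"
          and T = t and b' = "\<lambda>_. 0"])
      fix s x assume s: "0 \<le> s" "s \<le> t"
      show "((\<lambda>s. - (s * ?L s x)) has_real_derivative
         - (?L s x + s * (?S s x + 2 * Gamma_quad q 2 (u s) x))) (at s within {0..})"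
        by (auto intro!: derivative_eq_intros flow_laplacian_deriv[OF s(1)])
    next
      fix s x
      assume s: "0 < s" "s \<le> t" and eq: "- (s * ?L s x) = n / 2 + e"
        and le: "\<And>y. - (s * ?L s y) \<le> n / 2 + e"
      have "0 \<le> ?S s x"
      proof (rule sum_nonneg)
        fix y
        have "s * ?L s x \<le> s * ?L s y" using le[of y] eq by simp
        then show "0 \<le> q x y * (1 + u s y - u s x) * (?L s y - ?L s x)"
          using s(1) flow_Gamma_le[of s x] by (intro mult_nonneg_nonneg drift_weight_nonneg) auto
      qed
      then have "s * (2 * (?L s x)\<^sup>2 / n) \<le> s * (?S s x + 2 * Gamma_quad q 2 (u s) x)"
        using CD_ereal[OF curv n, of "u s" x] s(1) by (intro mult_left_mono) auto
      \<comment> \<open>At touching the second factor equals \<open>- 2 * e / n\<close>; its strict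
        sign comes from \<open>e\<close>.\<close>
      moreover have "0 < ?L s x * (1 + 2 / n * (s * ?L s x))"
      proof (rule mult_neg_neg)
        have "s * ?L s x < 0" using eq n e by simp
        then show "?L s x < 0" using s(1) by (simp add: mult_less_0_iff)
        have "s * ?L s x = - (n / 2 + e)" using eq by simp
        then show "1 + 2 / n * (s * ?L s x) < 0" using n e by (simp add: field_simps)
      qed
      moreover have "?L s x * (1 + 2 / n * (s * ?L s x)) = ?L s x + s * (2 * (?L s x)\<^sup>2 / n)"
        by (simp add: algebra_simps power2_eq_square)
      ultimately show "- (?L s x + s * (?S s x + 2 * Gamma_quad q 2 (u s) x)) < 0" by linarith
    qed (use t n e in auto)
    then show "- (t * laplacian q (u t) x) \<le> n / 2 + e" by simp
  qed
  then show ?thesis by simp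
qed

section \<open>Harnack inequality along edges and walks\<close>

text \<open>The derivative of the logarithmic term offsets the Li--Yau lower bound for \<Delta>u,
  leaving at least \<Gamma>u.\<close>

lemma flow_log_deriv:
  assumes t: "0 < t"
  obtains D where "((\<lambda>s. u s x + n / 2 * ln s) has_real_derivative D) (at t)"
    and "Gamma_quad q 1 (u t) x \<le> D"
proof
  have "((\<lambda>s. u s x) has_real_derivative laplacian q (u t) x + Gamma_quad q 1 (u t) x) (at t)"
    using flow_deriv[of t x] t at_within_interior[of t "{0..}"] by simp
  then show "((\<lambda>s. u s x + n / 2 * ln s) has_real_derivative
      laplacian q (u t) x + Gamma_quad q 1 (u t) x + n / 2 * (1 / t)) (at t)"
    using t by (auto intro!: derivative_eq_intros)
  have "0 \<le> laplacian q (u t) x + n / 2 * (1 / t)"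
    using li_yau[of t x] t by (simp add: field_simps)
  then show "Gamma_quad q 1 (u t) x
      \<le> laplacian q (u t) x + Gamma_quad q 1 (u t) x + n / 2 * (1 / t)" by simp
qed

lemma harnack_mono:
  assumes "0 < s" "s \<le> t"
  shows "u s x + n / 2 * ln s \<le> u t x + n / 2 * ln t"
proof (rule DERIV_nonneg_imp_nondecreasing[OF assms(2)])
  fix r assume "s \<le> r"
  then obtain D where "((\<lambda>s. u s x + n / 2 * ln s) has_real_derivative D) (at r)"
    "Gamma_quad q 1 (u r) x \<le> D"
    using flow_log_deriv[of r x] assms(1) by auto
  then show "\<exists>D. ((\<lambda>s. u s x + n / 2 * ln s) has_real_derivative D) (at r) \<and> 0 \<le> D"
    using Gamma_quad_nonneg[of "u r" x] by (blast intro: order_trans)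
qed

text \<open>\<Gamma> at the tail of a positive weight yields the Riccati inequality for that vertex,
  while the other one contributes monotonicity. So \<open>riccati_jump\<close> applies directly if
  \<open>0 < q x y\<close>.\<close>

lemma harnack_edge:
  assumes s: "0 < s" "s < t" and adj: "adjacent q x y"
  shows "u s x + n / 2 * ln s - (u t y + n / 2 * ln t) \<le> 2 / (q_min q * (t - s))"
proof -
  define \<phi> where "\<phi> = (\<lambda>x s. u s x + n / 2 * ln s)"
  have "\<forall>x s. \<exists>D. 0 < s \<longrightarrow> (\<phi> x has_real_derivative D) (at s) \<and> Gamma_quad q 1 (u s) x \<le> D"
    unfolding \<phi>_def using flow_log_deriv by metis
  then obtain D where D: "\<And>x s. 0 < s \<Longrightarrow> (\<phi> x has_real_derivative D x s) (at s)"
    and Dge: "\<And>x s. 0 < s \<Longrightarrow> Gamma_quad q 1 (u s) x \<le> D x s" by metis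
  have D0: "0 \<le> D x s" if "0 < s" for x s
    using Dge[OF that] Gamma_quad_nonneg by (blast intro: order_trans)
  have edge: "q_min q / 2 * (\<phi> x s - \<phi> y s)\<^sup>2 \<le> D x s" if "0 < q x y" "0 < s" for x y s
    using edge_le_Gamma[OF that(1), of "u s"] Dge[OF that(2), of x]
    by (simp add: \<phi>_def power2_commute)
  have c: "0 < q_min q / 2" using q_min_pos by simp
  from adj have "\<phi> x s - \<phi> y t \<le> 1 / (q_min q / 2 * (t - s))"
    unfolding adjacent_def
  proof
    assume "0 < q x y"
    then show ?thesis
      using s by (intro riccati_jump[OF s(2) c, of "\<phi> x" "D x" "\<phi> y" "D y"] D D0 edge) auto
  next
    assume qyx: "0 < q y x"
    \<comment> \<open>Reversing time and sign exchanges the two endpoints.\<close>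
    have rev: "((\<lambda>r. - \<phi> z (- r)) has_real_derivative D z (- r)) (at r)" if "r < 0" for z r
      using that by (auto intro!: derivative_eq_intros DERIV_chain'[where f = uminus, OF _ D])
    have "- \<phi> y (- (- t)) - (- \<phi> x (- (- s))) \<le> 1 / (q_min q / 2 * (- s - (- t)))"
    proof (rule riccati_jump[where \<phi>' = "\<lambda>r. D y (- r)" and \<psi>' = "\<lambda>r. D x (- r)"])
      fix r assume r: "- t \<le> r" "r \<le> - s"
      show "q_min q / 2 * (- \<phi> y (- r) - - \<phi> x (- r))\<^sup>2 \<le> D y (- r)"
        using edge[OF qyx, of "- r"] r s by (simp add: power2_commute)
    qed (use s c rev D0 in auto)
    then show ?thesis by simp
  qed
  then show ?thesis by (simp add: \<phi>_def)
qed

text \<open>Every edge is given the same time \<tau>, and the edge estimates telescope.\<close>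

lemma harnack_path:
  assumes "0 < s" "0 < \<tau>" "\<And>i. i < k \<Longrightarrow> adjacent q (p i) (p (Suc i))"
  shows "u s (p 0) + n / 2 * ln s - (u (s + k * \<tau>) (p k) + n / 2 * ln (s + k * \<tau>))
    \<le> k * (2 / (q_min q * \<tau>))"
  using assms(3)
proof (induction k)
  case (Suc k)
  have sk: "0 < s + k * \<tau>" using assms by (simp add: add_pos_nonneg)
  have "s + k * \<tau> < s + Suc k * \<tau>" using assms by (simp add: algebra_simps)
  from harnack_edge[OF sk this Suc.prems[of k]]
  have "u (s + k * \<tau>) (p k) + n / 2 * ln (s + k * \<tau>)
      - (u (s + Suc k * \<tau>) (p (Suc k)) + n / 2 * ln (s + Suc k * \<tau>)) \<le> 2 / (q_min q * \<tau>)"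
    by (simp add: algebra_simps)
  then show ?case using Suc.IH Suc.prems by (simp add: algebra_simps add_divide_distrib)
qed simp

text \<open>With \<open>k\<close> equal time steps each of the \<open>k\<close> edges costs
  \<open>2 * k / (q_min q * (T2 - T1))\<close>, whence the square. A walk of length 0 has no step
  size and is covered by monotonicity in time.\<close>

lemma harnack_walk:
  assumes T: "0 < T1" "T1 < T2" and p: "\<And>i. i < k \<Longrightarrow> adjacent q (p i) (p (Suc i))"
  shows "u T1 (p 0) - u T2 (p k)
    \<le> n / 2 * ln (T2 / T1) + 2 * (real k)\<^sup>2 / (q_min q * (T2 - T1))"
proof -
  have "u T1 (p 0) + n / 2 * ln T1 - (u T2 (p k) + n / 2 * ln T2)
      \<le> 2 * (real k)\<^sup>2 / (q_min q * (T2 - T1))"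
  proof (cases "k = 0")
    case True
    then show ?thesis using harnack_mono[of T1 T2 "p 0"] T by simp
  next
    case False
    have "real k * (2 / (q_min q * ((T2 - T1) / k))) = 2 * (real k)\<^sup>2 / (q_min q * (T2 - T1))"
      by (simp add: power2_eq_square)
    moreover have "u T1 (p 0) + n / 2 * ln T1 - (u T2 (p k) + n / 2 * ln T2)
        \<le> real k * (2 / (q_min q * ((T2 - T1) / k)))"
      using harnack_path[of T1 "(T2 - T1) / k" k p] T p False by simp
    ultimately show ?thesis by (simp only:)
  qed
  then show ?thesis using T by (simp add: ln_div right_diff_distrib)
qed

end
end
end

section \<open>Shortest walks and the final inequality\<close>

text \<open>A finite infimum means that the set of lengths is nonempty, and by well-ordering it is
  then attained.\<close>

lemma graph_dist_walk:
  assumes "graph_dist q x y = enat k"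
  obtains p where "p 0 = x" "p k = y" "\<forall>i<k. adjacent q (p i) (p (Suc i))"
proof -
  let ?S = "{enat k | k. \<exists>p :: nat \<Rightarrow> _. p 0 = x \<and> p k = y \<and> (\<forall>i<k. adjacent q (p i) (p (Suc i)))}"
  have "?S \<noteq> {}" using assms unfolding graph_dist_def by (force simp: Inf_enat_def)
  then have "Inf ?S \<in> ?S" unfolding Inf_enat_def using LeastI_ex[of "\<lambda>m. m \<in> ?S"] by auto
  then have "enat k \<in> ?S" using assms unfolding graph_dist_def by simp
  then show ?thesis using that by blast
qed

theorem theorem3p2:
  fixes q :: "'v::finite \<Rightarrow> 'v \<Rightarrow> real"
    and n T1 T2 :: real
    and u0 :: "'v \<Rightarrow> real"
    and u :: "real \<Rightarrow> 'v \<Rightarrow> real"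
    and x y :: 'v
  assumes "finite_graph q"
    and "\<exists>a b. q a b > 0"
    and "0 < n"
    and "CD q 0 (ereal n)"
    and "sup_norm (Gamma_quad q 1 u0) \<le> q_min q / 2"
    and "solves_gamma_flow q u0 u"
    and "0 < T1" and "T1 < T2"
  shows "ereal (u T1 x - u T2 y)
    \<le> ereal (n / 2 * ln (T2 / T1))
      + 2 * (ereal_of_enat (graph_dist q x y))\<^sup>2 / ereal (q_min q * (T2 - T1))"
proof (cases "graph_dist q x y")
  case (enat k)
  then obtain p where p: "p 0 = x" "p k = y" "\<forall>i<k. adjacent q (p i) (p (Suc i))"
    by (rule graph_dist_walk)
  have "u T1 (p 0) - u T2 (p k)
      \<le> n / 2 * ln (T2 / T1) + 2 * (real k)\<^sup>2 / (q_min q * (T2 - T1))"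
    by (rule harnack_walk[OF assms(1,2,6,3,4,5,7,8)]) (use p(3) in blast)
  moreover have "2 * (ereal_of_enat (graph_dist q x y))\<^sup>2 / ereal (q_min q * (T2 - T1))
      = ereal (2 * (real k)\<^sup>2 / (q_min q * (T2 - T1)))"
    using q_min_pos[OF assms(1,2)] assms(8) enat by simp
  ultimately show ?thesis using p(1,2) by (simp only: plus_ereal.simps ereal_less_eq)
next
  case infinity
  \<comment> \<open>Positivity of the denominator keeps the quotient, and so the right-hand side, at
    \<infinity>.\<close>
  have "0 < q_min q * (T2 - T1)" using q_min_pos[OF assms(1,2)] assms(8) by simp
  then show ?thesis using infinity by (simp add: power2_eq_square)
qed

end
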